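(* Let $H$ and $T$ be atomic cancellative small categories, and assume that there exists an isoatomic weak transfer homomorphism $\phi\colon H\to T$. Denote by $\phi_p\colon\mathsf Z_p(H)\to\mathsf Z_p(T)$ the extension of $\phi$ to permutable factorizations. Then $\mathsf d_p(z,z')=\mathsf d_p(\phi_p(z),\phi_p(z'))$ for any two permutable factorizations $z$ and $z'$ of $a\in H$. In particular, $\mathsf c_p(H)=\mathsf c_p(T)$.
   Context: **Small categories.** A small category $H$ is identified with its set of morphisms (elements); $H_0$ is the set of identities; $a\in H$ has source $s(a)$ and target $t(a)$, and $ab$ is defined iff $t(a)=s(b)$. Homomorphisms are functors. $H^\times$ is the set of isomorphisms (units); $H$ is cancellative if $ab=ac$ or $ba=ca$ implies $b=c$. $a\simeq b$ if $b=\varepsilon a\eta$ with units $\varepsilon,\eta$. An atom is a non-unit $u$ such that $u=ab$ implies $a$ or $b$ is a unit; $\mathcal A(H)$ is the set of atoms; $H$ is atomic if every non-unit is a finite product of atoms. **Factorizations.** Consider tuples $(\varepsilon;u_1,\dots,u_k)$, $k\ge0$, $\varepsilon\in H^\times$, $u_i\in\mathcal A(H)$ with $\varepsilon u_1\cdots u_k$ defined. Identify $(\varepsilon;u_1,\dots,u_k)$ and $(\varepsilon';v_1,\dots,v_l)$ if $k=l$, $\varepsilon u_1\cdots u_k=\varepsilon'v_1\cdots v_k$, and either $k=0$ or there are $\delta_2,\dots,\delta_k\in H^\times$, $\delta_{k+1}=t(u_k)$, with $\varepsilon'v_1=\varepsilon u_1\delta_2^{-1}$, $v_i=\delta_iu_i\delta_{i+1}^{-1}$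 ($i\in[2,k]$). The classes, written $\varepsilon*u_1*\cdots*u_k$, form the set $\mathsf Z^*(H)$ of rigid factorizations; $\pi(\varepsilon*u_1*\cdots*u_k)=\varepsilon u_1\cdots u_k$, and $\mathsf Z^*(a)=\pi^{-1}(\{a\})$. The permutable distance is $\mathsf d_p(\varepsilon*u_1*\cdots*u_k,\eta*v_1*\cdots*v_l)=\max\{k,l\}-n$, where $n$ is the largest cardinality of $I\subset[1,k]$ admitting an injection $\sigma:I\to[1,l]$ with $u_i\simeq v_{\sigma(i)}$ for $i\in I$. $\mathsf Z_p(H)$ is the quotient of $\mathsf Z^*(H)$ by: $z\sim z'$ iff $\pi(z)=\pi(z')$ and $\mathsf d_p(z,z')=0$; its elements are permutable factorizations, $[z]_p$ is the class of $z$, and $\mathsf Z_p(a)$ (the permutable factorizations of $a$) is the image of $\mathsf Z^*(a)$. $\mathsf d_p$ is well defined on pairs of elements of $\mathsf Z_p(a)$. **Catenary degree.** $\mathsf c_p(a)$ is the least $N\in\mathbb N_0\cup\{\infty\}$ such that for all $z,z'\in\mathsf Z^*(a)$ there are $z=z_0,\dots,z_n=z'$ in $\mathsf Z^*(a)$ with $\mathsf d_p(z_{i-1},z_i)\le N$ for all $i$; $\mathsf c_p(H)=\sup_{a\in H}\mathsf c_p(a)$. **Weak transfer homomorphisms.** For $T$ atomic, a homomorphism $\phi:H\to T$ of cancellative small categories is a weak transfer homomorphism if (T1) $T=T^\times\phi(H)T^\times$ and $\phi^{-1}(T^\times)=H^\times$, and (WT2) whenever $a\in H$, $n\in\mathbb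 N$, $v_1,\dots,v_n\in\mathcal A(T)$ and $\phi(a)=v_1\cdots v_n$, there are $u_1,\dots,u_n\in\mathcal A(H)$ and a permutation $\sigma$ of $[1,n]$ with $a=u_1\cdots u_n$ and $\phi(u_i)\simeq v_{\sigma(i)}$ for all $i$. It maps atoms to atoms. It is isoatomic if $\phi(u)\simeq\phi(v)$ implies $u\simeq v$ for all $u,v\in\mathcal A(H)$. The induced homomorphism is $\phi_p([\varepsilon*u_1*\cdots*u_k]_p)=[\phi(\varepsilon)*\phi(u_1)*\cdots*\phi(u_k)]_p$. *)

theory Defs
  imports "HOL-Library.Extended_Nat" "HOL-Combinatorics.Permutations"
begin

section \<open>Small categories\<close>

text \<open>
  A small category is its set of morphisms; objects are identified with their identity morphisms,
  so source and target are morphisms again. Composition is written in diagrammatic order: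
  the product of a and b is defined iff the target of a is the source of b. Outside that domain
  the composition operation is unspecified, so definedness is always stated explicitly below.
\<close>

record 'a small_cat =
  mor :: "'a set"
  src :: "'a \<Rightarrow> 'a"
  tgt :: "'a \<Rightarrow> 'a"
  cmp :: "'a \<Rightarrow> 'a \<Rightarrow> 'a" (infixl "\<odot>\<index>" 70)

locale small_category =
  fixes C :: "'a small_cat" (structure)
  assumes src_mor: "a \<in> mor C \<Longrightarrow> src C a \<in> mor C"
    and tgt_mor: "a \<in> mor C \<Longrightarrow> tgt C a \<in> mor C"
    and src_src: "a \<in> mor C \<Longrightarrow> src C (src C a) = src C a"
    and tgt_src: "a \<in> mor C \<Longrightarrow> tgt C (src C a) = src C a"
    and src_tgt: "a \<in> mor C \<Longrightarrow> src C (tgt C a) = tgt C a"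
    and tgt_tgt: "a \<in> mor C \<Longrightarrow> tgt C (tgt C a) = tgt C a"
    and cmp_mor: "\<lbrakk>a \<in> mor C; b \<in> mor C; tgt C a = src C b\<rbrakk> \<Longrightarrow> a \<odot> b \<in> mor C"
    and src_cmp: "\<lbrakk>a \<in> mor C; b \<in> mor C; tgt C a = src C b\<rbrakk> \<Longrightarrow> src C (a \<odot> b) = src C a"
    and tgt_cmp: "\<lbrakk>a \<in> mor C; b \<in> mor C; tgt C a = src C b\<rbrakk> \<Longrightarrow> tgt C (a \<odot> b) = tgt C b"
    and src_cmp_id: "a \<in> mor C \<Longrightarrow> src C a \<odot> a = a"
    and cmp_tgt_id: "a \<in> mor C \<Longrightarrow> a \<odot> tgt C a = a"
    and cmp_assoc: "\<lbrakk>a \<in> mor C; b \<in> mor C; c \<in> mor C; tgt C a = src C b; tgt C b = src C c\<rbrakk>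
        \<Longrightarrow> (a \<odot> b) \<odot> c = a \<odot> (b \<odot> c)"

locale cancellative_category = small_category +
  assumes left_cancel: "\<lbrakk>a \<in> mor C; b \<in> mor C; c \<in> mor C; tgt C a = src C b; tgt C a = src C c;
        a \<odot> b = a \<odot> c\<rbrakk> \<Longrightarrow> b = c"
    and right_cancel: "\<lbrakk>a \<in> mor C; b \<in> mor C; c \<in> mor C; tgt C b = src C a; tgt C c = src C a;
        b \<odot> a = c \<odot> a\<rbrakk> \<Longrightarrow> b = c"

definition is_functor :: "'a small_cat \<Rightarrow> 'b small_cat \<Rightarrow> ('a \<Rightarrow> 'b) \<Rightarrow> bool" where
  "is_functor C D f \<longleftrightarrow>
     (\<forall>a\<in>mor C. f a \<in> mor D \<and> f (src C a) = src D (f a) \<and> f (tgt C a) = tgt D (f a)) \<and>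
     (\<forall>a\<in>mor C. \<forall>b\<in>mor C. tgt C a = src C b \<longrightarrow> f (a \<odot>\<^bsub>C\<^esub> b) = f a \<odot>\<^bsub>D\<^esub> f b)"

definition inverse_mor :: "'a small_cat \<Rightarrow> 'a \<Rightarrow> 'a \<Rightarrow> bool" where
  "inverse_mor C a b \<longleftrightarrow> a \<in> mor C \<and> b \<in> mor C \<and> tgt C a = src C b \<and> tgt C b = src C a \<and>
     a \<odot>\<^bsub>C\<^esub> b = src C a \<and> b \<odot>\<^bsub>C\<^esub> a = tgt C a"

definition units :: "'a small_cat \<Rightarrow> 'a set" where
  "units C = {a \<in> mor C. \<exists>b. inverse_mor C a b}"

definition inv_mor :: "'a small_cat \<Rightarrow> 'a \<Rightarrow> 'a" where
  "inv_mor C a = (THE b. inverse_mor C a b)"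

definition assoc_mor :: "'a small_cat \<Rightarrow> 'a \<Rightarrow> 'a \<Rightarrow> bool" where
  "assoc_mor C a b \<longleftrightarrow> a \<in> mor C \<and> b \<in> mor C \<and>
     (\<exists>\<epsilon>\<in>units C. \<exists>\<eta>\<in>units C. tgt C \<epsilon> = src C a \<and> tgt C a = src C \<eta> \<and>
        b = \<epsilon> \<odot>\<^bsub>C\<^esub> a \<odot>\<^bsub>C\<^esub> \<eta>)"

definition atoms :: "'a small_cat \<Rightarrow> 'a set" where
  "atoms C = {u \<in> mor C - units C. \<forall>a\<in>mor C. \<forall>b\<in>mor C.
     tgt C a = src C b \<and> u = a \<odot>\<^bsub>C\<^esub> b \<longrightarrow> a \<in> units C \<or> b \<in> units C}"

definition composable :: "'a small_cat \<Rightarrow> 'a list \<Rightarrow> bool" where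
  "composable C as \<longleftrightarrow> set as \<subseteq> mor C \<and> successively (\<lambda>a b. tgt C a = src C b) as"

text \<open>Only meaningful for nonempty composable lists (a category has no global empty product).\<close>

definition product :: "'a small_cat \<Rightarrow> 'a list \<Rightarrow> 'a" where
  "product C as = foldl (cmp C) (hd as) (tl as)"

definition atomic :: "'a small_cat \<Rightarrow> bool" where
  "atomic C \<longleftrightarrow> (\<forall>a \<in> mor C - units C. \<exists>us. us \<noteq> [] \<and> set us \<subseteq> atoms C \<and>
     composable C us \<and> a = product C us)"


section \<open>Rigid and permutable factorizations\<close>

text \<open>The pair (\<open>\<epsilon>\<close>, [u1, ..., uk]) stands for the tuple (\<open>\<epsilon>\<close>; u1, ..., uk).\<close>

type_synonym 'a fact_tuple = "'a \<times> 'a list"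

definition fact_tuples :: "'a small_cat \<Rightarrow> 'a fact_tuple set" where
  "fact_tuples C = {(\<epsilon>, us). \<epsilon> \<in> units C \<and> set us \<subseteq> atoms C \<and> composable C (\<epsilon> # us)}"

definition tuple_prod :: "'a small_cat \<Rightarrow> 'a fact_tuple \<Rightarrow> 'a" where
  "tuple_prod C x = product C (fst x # snd x)"

text \<open>
  List positions start at 0, so \<open>us ! i\<close> is the (i+1)-st atom; accordingly \<open>\<delta> i\<close> is the
  unit usually indexed i+1, and \<open>\<delta> (length us)\<close> is the identity at the target of the last
  atom. The condition on the target of \<open>\<delta> i\<close> makes all products below defined.
\<close>

definition rigid_rel :: "'a small_cat \<Rightarrow> ('a fact_tuple \<times> 'a fact_tuple) set" where
  "rigid_rel C = {((\<epsilon>, us), (\<epsilon>', vs)).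
     (\<epsilon>, us) \<in> fact_tuples C \<and> (\<epsilon>', vs) \<in> fact_tuples C \<and>
     length us = length vs \<and> tuple_prod C (\<epsilon>, us) = tuple_prod C (\<epsilon>', vs) \<and>
     (us = [] \<or>
      (\<exists>\<delta> :: nat \<Rightarrow> 'a.
         (\<forall>i\<in>{1..<length us}. \<delta> i \<in> units C \<and> tgt C (\<delta> i) = src C (us ! i)) \<and>
         \<delta> (length us) = tgt C (last us) \<and>
         \<epsilon>' \<odot>\<^bsub>C\<^esub> vs ! 0 = \<epsilon> \<odot>\<^bsub>C\<^esub> us ! 0 \<odot>\<^bsub>C\<^esub> inv_mor C (\<delta> 1) \<and>
         (\<forall>i\<in>{1..<length us}. vs ! i = \<delta> i \<odot>\<^bsub>C\<^esub> us ! i \<odot>\<^bsub>C\<^esub> inv_mor C (\<delta> (Suc i)))))}"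

type_synonym 'a rigid_fact = "'a fact_tuple set"

definition rigid_facts :: "'a small_cat \<Rightarrow> 'a rigid_fact set" where
  "rigid_facts C = fact_tuples C // rigid_rel C"

definition rigid_class :: "'a small_cat \<Rightarrow> 'a fact_tuple \<Rightarrow> 'a rigid_fact" where
  "rigid_class C x = rigid_rel C `` {x}"

text \<open>
  Functions on equivalence classes are lifted from representatives with \<^const>\<open>the_elem\<close>: the
  image of the class under the function on representatives is a singleton exactly when the
  function is well defined on that class.
\<close>

definition rigid_prod :: "'a small_cat \<Rightarrow> 'a rigid_fact \<Rightarrow> 'a" where
  "rigid_prod C z = the_elem (tuple_prod C ` z)"

definition rigid_facts_of :: "'a small_cat \<Rightarrow> 'a \<Rightarrow> 'a rigid_fact set" where
  "rigid_facts_of C a = {z \<in> rigid_facts C. rigid_prod C z = a}"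

definition tuple_dist :: "'a small_cat \<Rightarrow> 'a fact_tuple \<Rightarrow> 'a fact_tuple \<Rightarrow> nat" where
  "tuple_dist C x y = (let us = snd x; vs = snd y in
     max (length us) (length vs) -
     Max {card I | I. I \<subseteq> {..<length us} \<and>
       (\<exists>\<sigma>. inj_on \<sigma> I \<and> \<sigma> ` I \<subseteq> {..<length vs} \<and>
          (\<forall>i\<in>I. assoc_mor C (us ! i) (vs ! \<sigma> i)))})"

definition rigid_dist :: "'a small_cat \<Rightarrow> 'a rigid_fact \<Rightarrow> 'a rigid_fact \<Rightarrow> nat" where
  "rigid_dist C z z' = the_elem ((\<lambda>(x, y). tuple_dist C x y) ` (z \<times> z'))"

definition perm_rel :: "'a small_cat \<Rightarrow> ('a rigid_fact \<times> 'a rigid_fact) set" where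
  "perm_rel C = {(z, z'). z \<in> rigid_facts C \<and> z' \<in> rigid_facts C \<and>
     rigid_prod C z = rigid_prod C z' \<and> rigid_dist C z z' = 0}"

type_synonym 'a perm_fact = "'a rigid_fact set"

definition perm_class :: "'a small_cat \<Rightarrow> 'a rigid_fact \<Rightarrow> 'a perm_fact" where
  "perm_class C z = perm_rel C `` {z}"

definition perm_facts_of :: "'a small_cat \<Rightarrow> 'a \<Rightarrow> 'a perm_fact set" where
  "perm_facts_of C a = perm_class C ` rigid_facts_of C a"

definition perm_dist :: "'a small_cat \<Rightarrow> 'a perm_fact \<Rightarrow> 'a perm_fact \<Rightarrow> nat" where
  "perm_dist C Z Z' = the_elem ((\<lambda>(z, z'). rigid_dist C z z') ` (Z \<times> Z'))"


section \<open>Catenary degree\<close>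

definition perm_catenary_of :: "'a small_cat \<Rightarrow> 'a \<Rightarrow> enat" where
  "perm_catenary_of C a = (LEAST N :: enat. \<forall>z\<in>rigid_facts_of C a. \<forall>z'\<in>rigid_facts_of C a.
     \<exists>(n :: nat) (c :: nat \<Rightarrow> 'a rigid_fact). c 0 = z \<and> c n = z' \<and>
       (\<forall>i\<in>{0..n}. c i \<in> rigid_facts_of C a) \<and>
       (\<forall>i\<in>{1..n}. enat (rigid_dist C (c (i - 1)) (c i)) \<le> N))"

definition perm_catenary :: "'a small_cat \<Rightarrow> enat" where
  "perm_catenary C = (SUP a\<in>mor C. perm_catenary_of C a)"


section \<open>Weak transfer homomorphisms\<close>

definition transfer_T1 :: "'a small_cat \<Rightarrow> 'b small_cat \<Rightarrow> ('a \<Rightarrow> 'b) \<Rightarrow> bool" where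
  "transfer_T1 H T \<phi> \<longleftrightarrow>
     mor T = {\<epsilon> \<odot>\<^bsub>T\<^esub> \<phi> a \<odot>\<^bsub>T\<^esub> \<eta> | \<epsilon> a \<eta>. \<epsilon> \<in> units T \<and> a \<in> mor H \<and> \<eta> \<in> units T \<and>
        tgt T \<epsilon> = src T (\<phi> a) \<and> tgt T (\<phi> a) = src T \<eta>} \<and>
     {a \<in> mor H. \<phi> a \<in> units T} = units H"

definition transfer_WT2 :: "'a small_cat \<Rightarrow> 'b small_cat \<Rightarrow> ('a \<Rightarrow> 'b) \<Rightarrow> bool" where
  "transfer_WT2 H T \<phi> \<longleftrightarrow>
     (\<forall>a\<in>mor H. \<forall>vs. vs \<noteq> [] \<and> set vs \<subseteq> atoms T \<and> composable T vs \<and> \<phi> a = product T vs \<longrightarrow>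
        (\<exists>us \<sigma>. length us = length vs \<and> set us \<subseteq> atoms H \<and> composable H us \<and>
           a = product H us \<and> \<sigma> permutes {..<length vs} \<and>
           (\<forall>i<length vs. assoc_mor T (\<phi> (us ! i)) (vs ! \<sigma> i))))"

definition weak_transfer_hom :: "'a small_cat \<Rightarrow> 'b small_cat \<Rightarrow> ('a \<Rightarrow> 'b) \<Rightarrow> bool" where
  "weak_transfer_hom H T \<phi> \<longleftrightarrow> is_functor H T \<phi> \<and> transfer_T1 H T \<phi> \<and> transfer_WT2 H T \<phi>"

definition isoatomic :: "'a small_cat \<Rightarrow> 'b small_cat \<Rightarrow> ('a \<Rightarrow> 'b) \<Rightarrow> bool" where
  "isoatomic H T \<phi> \<longleftrightarrow>
     (\<forall>u\<in>atoms H. \<forall>v\<in>atoms H. assoc_mor T (\<phi> u) (\<phi> v) \<longrightarrow> assoc_mor H u v)"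

text \<open>The representatives of a permutable factorization Z are the tuples in the union of Z.\<close>

definition perm_extension ::
    "'b small_cat \<Rightarrow> ('a \<Rightarrow> 'b) \<Rightarrow> 'a perm_fact \<Rightarrow> 'b perm_fact" where
  "perm_extension T \<phi> Z =
     the_elem ((\<lambda>(\<epsilon>, us). perm_class T (rigid_class T (\<phi> \<epsilon>, map \<phi> us))) ` \<Union>Z)"

end

(*
  Rigidly equivalent tuples have pairwise associated entries, so the permutable
  distance of two factorizations depends only on the atoms involved up to order and association.
  An isoatomic weak transfer homomorphism preserves and reflects association of atoms, hence
  preserves the distance.  If b in T is associated to the image of a in H, then absorbing units into
  the outer entries and lifting by (WT2) matches the factorizations of a and of b up to order and
  association of atoms; chains can thus be moved back and forth, and a and b have the same catenary
  degree.  By (T1), every b in T is of this kind.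
*)
theory Submission
  imports Defs
begin

section \<open>Units and associated morphisms\<close>

text \<open>The two sides are compared through a relation, not a map: (WT2) permutes the given atoms
  and recovers them only up to association, so a factorization has no canonical partner. The
  relation \<open>lifts\<close> pairs an atom \<open>u\<close> of \<open>H\<close> with everything
  associated to \<open>\<phi> u\<close>. Functoriality in one direction and isoatomicity in the
  other make it match the two association relations exactly, and a distance that counts associated
  pairs cannot tell matched lists apart. The ambiguity is harmless: two partners of one
  factorization are at distance 0, so every bound on chains admits a step between them. The second
  obstacle is units. (T1) supplies a unit on each side of \<open>\<phi> a\<close>, whereas a tuple
  has a slot for a unit only on the left, and (WT2) speaks of products of atoms without any leading
  unit. Units therefore have to be pushed into an outer atom, with a separate treatment of
  factorizations without atoms. Finally, \<open>perm_dist\<close> and \<open>perm_extension\<close>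
  are read off from representatives by \<open>the_elem\<close>, so each must be shown constant on
  classes of classes.\<close>

context small_category
begin

lemmas cat_simps = src_mor tgt_mor src_src tgt_src src_tgt tgt_tgt cmp_mor src_cmp tgt_cmp
  src_cmp_id cmp_tgt_id

lemma inverse_mor_unique:
  assumes "inverse_mor C a b" "inverse_mor C a c"
  shows "b = c"
proof -
  have m: "a \<in> mor C" "b \<in> mor C" "c \<in> mor C" "tgt C b = src C a" "tgt C a = src C c"
    and e: "a \<odot> c = src C a" "b \<odot> a = tgt C a"
    using assms by (auto simp: inverse_mor_def)
  have "b = b \<odot> (a \<odot> c)" using m e cmp_tgt_id[of b] by simp
  also have "\<dots> = (b \<odot> a) \<odot> c" using m by (simp add: cmp_assoc)
  also have "\<dots> = c" using m e src_cmp_id[of c] by simp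
  finally show ?thesis .
qed

lemma inv_mor_eqI: "inverse_mor C a b \<Longrightarrow> inv_mor C a = b"
  unfolding inv_mor_def by (blast intro: inverse_mor_unique)

lemma unit_mor: "a \<in> units C \<Longrightarrow> a \<in> mor C"
  by (simp add: units_def)

lemma inverse_mor_sym: "inverse_mor C a b \<Longrightarrow> inverse_mor C b a"
  by (auto simp: inverse_mor_def)

lemma unitI: "inverse_mor C a b \<Longrightarrow> a \<in> units C"
  by (auto simp: units_def inverse_mor_def)

lemma unit_inverse: "a \<in> units C \<Longrightarrow> inverse_mor C a (inv_mor C a)"
  unfolding units_def using inv_mor_eqI by force

lemma inv_mor_unit: "a \<in> units C \<Longrightarrow> inv_mor C a \<in> units C"
  by (rule unitI[OF inverse_mor_sym[OF unit_inverse]])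

lemma src_inv_mor: "a \<in> units C \<Longrightarrow> src C (inv_mor C a) = tgt C a"
  and tgt_inv_mor: "a \<in> units C \<Longrightarrow> tgt C (inv_mor C a) = src C a"
  and cmp_inv_mor: "a \<in> units C \<Longrightarrow> a \<odot> inv_mor C a = src C a"
  and inv_mor_cmp: "a \<in> units C \<Longrightarrow> inv_mor C a \<odot> a = tgt C a"
  using unit_inverse[of a] by (auto simp: inverse_mor_def)

lemmas unit_simps = unit_mor inv_mor_unit src_inv_mor tgt_inv_mor

lemma inverse_mor_src: "a \<in> mor C \<Longrightarrow> inverse_mor C (src C a) (src C a)"
  using src_cmp_id[of "src C a"] by (simp add: inverse_mor_def cat_simps)

lemma inverse_mor_tgt: "a \<in> mor C \<Longrightarrow> inverse_mor C (tgt C a) (tgt C a)"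
  using cmp_tgt_id[of "tgt C a"] by (simp add: inverse_mor_def cat_simps)

lemma src_unit: "a \<in> mor C \<Longrightarrow> src C a \<in> units C"
  by (rule unitI[OF inverse_mor_src])

lemma tgt_unit: "a \<in> mor C \<Longrightarrow> tgt C a \<in> units C"
  by (rule unitI[OF inverse_mor_tgt])

lemma inv_cmp_cancel:
  assumes "e \<in> units C" "a \<in> mor C" "tgt C e = src C a"
  shows "inv_mor C e \<odot> (e \<odot> a) = a"
proof -
  have "inv_mor C e \<odot> (e \<odot> a) = (inv_mor C e \<odot> e) \<odot> a"
    using assms by (simp add: cmp_assoc unit_simps)
  then show ?thesis using assms by (simp add: inv_mor_cmp src_cmp_id)
qed

lemma cancel_cmp_inv:
  assumes "e \<in> units C" "a \<in> mor C" "tgt C a = src C e"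
  shows "(a \<odot> e) \<odot> inv_mor C e = a"
proof -
  have "(a \<odot> e) \<odot> inv_mor C e = a \<odot> (e \<odot> inv_mor C e)"
    using assms by (simp add: cmp_assoc unit_simps)
  then show ?thesis using assms cmp_tgt_id[of a] by (simp add: cmp_inv_mor)
qed

lemma unit_cmp:
  assumes "a \<in> units C" "b \<in> units C" "tgt C a = src C b"
  shows "a \<odot> b \<in> units C"
proof -
  let ?c = "inv_mor C b \<odot> inv_mor C a"
  have "(a \<odot> b) \<odot> ?c = ((a \<odot> b) \<odot> inv_mor C b) \<odot> inv_mor C a"
    using assms by (simp add: cmp_assoc unit_simps cat_simps)
  also have "\<dots> = src C a" using assms by (simp add: cancel_cmp_inv unit_simps cmp_inv_mor)
  finally have 1: "(a \<odot> b) \<odot> ?c = src C a" .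
  have "?c \<odot> (a \<odot> b) = inv_mor C b \<odot> (inv_mor C a \<odot> (a \<odot> b))"
    using assms by (simp add: cmp_assoc unit_simps cat_simps)
  also have "\<dots> = tgt C b" using assms by (simp add: inv_cmp_cancel unit_simps inv_mor_cmp)
  finally have 2: "?c \<odot> (a \<odot> b) = tgt C b" .
  have "inverse_mor C (a \<odot> b) ?c"
    using assms 1 2 by (simp add: inverse_mor_def unit_simps cat_simps)
  then show ?thesis by (rule unitI)
qed

lemma unit_cmp_left_iff:
  assumes "e \<in> units C" "a \<in> mor C" "tgt C e = src C a"
  shows "e \<odot> a \<in> units C \<longleftrightarrow> a \<in> units C"
  using assms unit_cmp[of "inv_mor C e" "e \<odot> a"] unit_cmp[of e a]
  by (auto simp: inv_cmp_cancel unit_simps cat_simps)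

lemma unit_cmp_right_iff:
  assumes "e \<in> units C" "a \<in> mor C" "tgt C a = src C e"
  shows "a \<odot> e \<in> units C \<longleftrightarrow> a \<in> units C"
  using assms unit_cmp[of "a \<odot> e" "inv_mor C e"] unit_cmp[of a e]
  by (auto simp: cancel_cmp_inv unit_simps cat_simps)

lemma assoc_morI:
  assumes "a \<in> mor C" "e \<in> units C" "h \<in> units C" "tgt C e = src C a" "tgt C a = src C h"
  shows "assoc_mor C a (e \<odot> a \<odot> h)"
  using assms by (auto simp: assoc_mor_def unit_simps cat_simps)

lemma assoc_morE:
  assumes "assoc_mor C a b"
  obtains e h where "a \<in> mor C" "b \<in> mor C" "e \<in> units C" "h \<in> units C" "tgt C e = src C a"
    "tgt C a = src C h" "b = e \<odot> a \<odot> h"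
  using assms by (auto simp: assoc_mor_def)

lemma assoc_mor_left:
  assumes "a \<in> mor C" "e \<in> units C" "tgt C e = src C a"
  shows "assoc_mor C a (e \<odot> a)"
  using assoc_morI[of a e "tgt C a"] assms cmp_tgt_id[of "e \<odot> a"]
  by (simp add: tgt_unit cat_simps unit_simps)

lemma assoc_mor_right:
  assumes "a \<in> mor C" "e \<in> units C" "tgt C a = src C e"
  shows "assoc_mor C a (a \<odot> e)"
  using assoc_morI[of a "src C a" e] assms by (simp add: src_unit cat_simps unit_simps)

lemma assoc_mor_refl: "a \<in> mor C \<Longrightarrow> assoc_mor C a a"
  using assoc_mor_left[of a "src C a"] by (simp add: src_unit cat_simps)

lemma assoc_mor_sym:
  assumes "assoc_mor C a b"
  shows "assoc_mor C b a"
proof -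
  obtain e h where *: "a \<in> mor C" "b \<in> mor C" "e \<in> units C" "h \<in> units C" "tgt C e = src C a"
    "tgt C a = src C h" "b = e \<odot> a \<odot> h" using assms by (rule assoc_morE)
  have "inv_mor C e \<odot> b \<odot> inv_mor C h = inv_mor C e \<odot> ((e \<odot> a) \<odot> h \<odot> inv_mor C h)"
    using * by (simp add: cmp_assoc unit_simps cat_simps)
  also have "\<dots> = a" using * by (simp only: cancel_cmp_inv inv_cmp_cancel unit_simps cat_simps)
  finally have "a = inv_mor C e \<odot> b \<odot> inv_mor C h" by simp
  moreover have "tgt C (inv_mor C e) = src C b" "tgt C b = src C (inv_mor C h)"
    using * by (simp_all add: unit_simps cat_simps)
  ultimately show ?thesis using assoc_morI[of b "inv_mor C e" "inv_mor C h"] *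
    by (simp add: unit_simps)
qed

lemma assoc_mor_trans:
  assumes "assoc_mor C a b" "assoc_mor C b c"
  shows "assoc_mor C a c"
proof -
  obtain e h where *: "a \<in> mor C" "b \<in> mor C" "e \<in> units C" "h \<in> units C" "tgt C e = src C a"
    "tgt C a = src C h" "b = e \<odot> a \<odot> h" using assms(1) by (rule assoc_morE)
  obtain e' h' where **: "e' \<in> units C" "h' \<in> units C" "tgt C e' = src C b"
    "tgt C b = src C h'" "c = e' \<odot> b \<odot> h'" using assms(2) by (rule assoc_morE)
  have "c = (e' \<odot> e) \<odot> a \<odot> (h \<odot> h')"
    using * ** by (simp add: cmp_assoc unit_simps cat_simps)
  then show ?thesis using assoc_morI[of a "e' \<odot> e" "h \<odot> h'"] * **
    by (simp add: unit_cmp unit_simps cat_simps)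
qed

lemma assoc_mor_unit_iff: "assoc_mor C a b \<Longrightarrow> b \<in> units C \<longleftrightarrow> a \<in> units C"
  by (elim assoc_morE) (simp add: unit_cmp_left_iff unit_cmp_right_iff unit_simps cat_simps)

lemma atom_mor: "u \<in> atoms C \<Longrightarrow> u \<in> mor C"
  by (simp add: atoms_def)

text \<open>A splitting of \<open>v\<close> becomes a splitting of \<open>u = e v h\<close> once
  \<open>e\<close> is merged into the left factor and \<open>h\<close> into the right one; neither
  merge changes whether a factor is a unit.\<close>

lemma atom_assoc:
  assumes u: "u \<in> atoms C" and uv: "assoc_mor C u v"
  shows "v \<in> atoms C"
proof -
  have v: "v \<in> mor C - units C"
    using assoc_mor_unit_iff[OF uv] u uv by (auto simp: atoms_def assoc_mor_def)
  have "a \<in> units C \<or> b \<in> units C"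
    if ab: "a \<in> mor C" "b \<in> mor C" "tgt C a = src C b" "v = a \<odot> b" for a b
  proof -
    obtain e h where *: "e \<in> units C" "h \<in> units C" "tgt C e = src C v" "tgt C v = src C h"
      "u = e \<odot> v \<odot> h" using assoc_mor_sym[OF uv] by (rule assoc_morE)
    have "u = (e \<odot> a) \<odot> (b \<odot> h)"
      using * ab by (simp add: cmp_assoc unit_simps cat_simps)
    moreover have "e \<odot> a \<in> mor C" "b \<odot> h \<in> mor C" "tgt C (e \<odot> a) = src C (b \<odot> h)"
      using * ab by (simp_all add: unit_simps cat_simps)
    ultimately have "e \<odot> a \<in> units C \<or> b \<odot> h \<in> units C" using u unfolding atoms_def by blast
    then show ?thesis
      using * ab by (simp add: unit_cmp_left_iff unit_cmp_right_iff cat_simps)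
  qed
  then show ?thesis using v by (auto simp: atoms_def)
qed

section \<open>Products of composable lists\<close>

lemma composable_Cons:
  "composable C (a # as) \<longleftrightarrow>
     a \<in> mor C \<and> (as = [] \<or> tgt C a = src C (hd as)) \<and> composable C as"
  by (cases as) (auto simp: composable_def)

lemma composable_snoc:
  "composable C (as @ [b]) \<longleftrightarrow>
     b \<in> mor C \<and> (as = [] \<or> tgt C (last as) = src C b) \<and> composable C as"
  by (auto simp: composable_def successively_append_iff)

lemma composable_nth: "composable C as \<Longrightarrow> Suc i < length as \<Longrightarrow> tgt C (as ! i) = src C (as ! Suc i)"
  by (simp add: composable_def successively_conv_nth)

text \<open>\<open>product\<close> folds from the left, so splitting off the first factor needs
  associativity. The induction generalizes \<open>b\<close> because one step of the fold replaces
  \<open>b, c\<close> by their composite.\<close>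

lemma product_Cons:
  "composable C (a # b # cs) \<Longrightarrow> product C (a # b # cs) = a \<odot> product C (b # cs)"
proof (induction cs arbitrary: b)
  case Nil
  then show ?case by (simp add: product_def)
next
  case (Cons c cs)
  have m: "a \<in> mor C" "b \<in> mor C" "c \<in> mor C" "tgt C a = src C b" "tgt C b = src C c"
    using Cons.prems by (auto simp: composable_Cons)
  have "composable C (b \<odot> c # cs)" "composable C (a # b \<odot> c # cs)"
    using Cons.prems by (auto simp: composable_Cons cat_simps)
  from Cons.IH[OF this(2)] show ?case using m by (simp add: product_def cmp_assoc)
qed

lemma product_snoc: "as \<noteq> [] \<Longrightarrow> product C (as @ [b]) = product C as \<odot> b"
  by (cases as) (auto simp: product_def)

lemma product_mor_tgt:
  assumes "composable C as" "as \<noteq> []"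
  shows "product C as \<in> mor C \<and> src C (product C as) = src C (hd as) \<and>
    tgt C (product C as) = tgt C (last as)"
  using assms
proof (induction as)
  case (Cons a as)
  show ?case
  proof (cases as)
    case Nil
    then show ?thesis using Cons.prems by (simp add: product_def composable_Cons)
  next
    case (Cons b bs)
    with Cons.prems have "composable C (a # b # bs)" by simp
    with Cons.IH show ?thesis using Cons product_Cons[of a b bs]
      by (auto simp: composable_Cons cat_simps)
  qed
qed simp

end

text \<open>The morphism \<open>b (a b)^-1\<close> is a right inverse \<open>c\<close> of
  \<open>a\<close>. From \<open>a (c a) = a = a t(a)\<close>, cancelling \<open>a\<close> on the
  left shows that \<open>c\<close> is a left inverse too.\<close>

lemma (in cancellative_category) left_factor_unit:
  assumes "a \<in> mor C" "b \<in> mor C" "tgt C a = src C b" "a \<odot> b \<in> units C"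
  shows "a \<in> units C"
proof -
  let ?c = "b \<odot> inv_mor C (a \<odot> b)"
  have c: "?c \<in> mor C" "src C ?c = tgt C a" "tgt C ?c = src C a"
    using assms by (simp_all add: unit_simps cat_simps)
  have ac: "a \<odot> ?c = src C a"
    using assms cmp_inv_mor[of "a \<odot> b"] by (simp add: cmp_assoc unit_simps cat_simps)
  have "a \<odot> (?c \<odot> a) = (a \<odot> ?c) \<odot> a" using c assms by (simp only: cmp_assoc)
  also have "\<dots> = a \<odot> tgt C a"
    using assms ac src_cmp_id[of a] cmp_tgt_id[of a] by simp
  finally have "?c \<odot> a = tgt C a"
    using left_cancel[of a "?c \<odot> a" "tgt C a"] c assms by (simp add: cat_simps)
  then have "inverse_mor C a ?c" using c ac assms by (simp add: inverse_mor_def)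
  then show ?thesis by (rule unitI)
qed


section \<open>Matchings of lists\<close>

text \<open>The two lists may have different entry types, so that this one notion covers both
  association inside a category and the passage from atoms of \<open>H\<close> to atoms of
  \<open>T\<close>.\<close>

definition perm_related :: "('a \<Rightarrow> 'b \<Rightarrow> bool) \<Rightarrow> 'a list \<Rightarrow> 'b list \<Rightarrow> bool" where
  "perm_related R us vs \<longleftrightarrow> (\<exists>\<sigma>. bij_betw \<sigma> {..<length us} {..<length vs} \<and>
     (\<forall>i<length us. R (us ! i) (vs ! \<sigma> i)))"

lemma perm_related_length: "perm_related R us vs \<Longrightarrow> length us = length vs"
  unfolding perm_related_def by (auto dest: bij_betw_same_card)

lemma perm_relatedI:
  assumes "length us = length vs" "\<And>i. i < length us \<Longrightarrow> R (us ! i) (vs ! i)"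
  shows "perm_related R us vs"
  unfolding perm_related_def using assms by (intro exI[of _ id]) auto

lemma perm_related_mono:
  "perm_related R us vs \<Longrightarrow> (\<And>u v. R u v \<Longrightarrow> S u v) \<Longrightarrow> perm_related S us vs"
  unfolding perm_related_def by blast

lemma perm_related_converse:
  assumes "perm_related R us vs"
  shows "perm_related (\<lambda>v u. R u v) vs us"
proof -
  obtain \<sigma> where \<sigma>: "bij_betw \<sigma> {..<length us} {..<length vs}"
    "\<forall>i<length us. R (us ! i) (vs ! \<sigma> i)" using assms by (auto simp: perm_related_def)
  let ?\<tau> = "inv_into {..<length us} \<sigma>"
  have \<tau>: "bij_betw ?\<tau> {..<length vs} {..<length us}" using \<sigma>(1) by (rule bij_betw_inv_into)
  have "R (us ! ?\<tau> j) (vs ! j)" if "j < length vs" for j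
  proof -
    have "?\<tau> j < length us" using \<tau> that by (auto simp: bij_betw_def)
    then show ?thesis using \<sigma> that bij_betw_inv_into_right[OF \<sigma>(1), of j] by force
  qed
  then show ?thesis unfolding perm_related_def using \<tau> by blast
qed

lemma perm_related_compose:
  assumes "perm_related R us vs" "perm_related S vs ws"
    and "\<And>u v w. R u v \<Longrightarrow> S v w \<Longrightarrow> Q u w"
  shows "perm_related Q us ws"
proof -
  obtain \<sigma> where \<sigma>: "bij_betw \<sigma> {..<length us} {..<length vs}"
    "\<forall>i<length us. R (us ! i) (vs ! \<sigma> i)" using assms by (auto simp: perm_related_def)
  obtain \<tau> where \<tau>: "bij_betw \<tau> {..<length vs} {..<length ws}"
    "\<forall>i<length vs. S (vs ! i) (ws ! \<tau> i)" using assms by (auto simp: perm_related_def)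
  have "Q (us ! i) (ws ! (\<tau> \<circ> \<sigma>) i)" if "i < length us" for i
  proof -
    have "\<sigma> i < length vs" using \<sigma>(1) that by (auto simp: bij_betw_def)
    then show ?thesis using \<sigma>(2) \<tau>(2) that assms(3) by auto
  qed
  then show ?thesis unfolding perm_related_def using bij_betw_trans[OF \<sigma>(1) \<tau>(1)] by blast
qed

text \<open>This is the set whose maximum enters \<open>tuple_dist\<close>, with association
  replaced by a parameter so that matchings in different categories can be compared.\<close>

definition matching_sizes :: "('a \<Rightarrow> 'b \<Rightarrow> bool) \<Rightarrow> 'a list \<Rightarrow> 'b list \<Rightarrow> nat set" where
  "matching_sizes P us vs = {card I | I. I \<subseteq> {..<length us} \<and>
     (\<exists>\<sigma>. inj_on \<sigma> I \<and> \<sigma> ` I \<subseteq> {..<length vs} \<and> (\<forall>i\<in>I. P (us ! i) (vs ! \<sigma> i)))}"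

lemma tuple_dist_matching:
  "tuple_dist C x y = max (length (snd x)) (length (snd y)) -
     Max (matching_sizes (assoc_mor C) (snd x) (snd y))"
  by (simp add: tuple_dist_def matching_sizes_def Let_def)

text \<open>A partial matching \<open>m\<close> on \<open>I\<close> is transported to
  \<open>\<tau> o m o \<sigma>^-1\<close> on the image of \<open>I\<close> under
  \<open>\<sigma>\<close>, which has the same cardinality. The converse matchings give the opposite
  inclusion.\<close>

lemma matching_sizes_subset:
  assumes us: "perm_related R us us'" and vs: "perm_related S vs vs'"
    and PQ: "\<And>u u' v v'. R u u' \<Longrightarrow> S v v' \<Longrightarrow> P u v \<Longrightarrow> Q u' v'"
  shows "matching_sizes P us vs \<subseteq> matching_sizes Q us' vs'"
proof
  fix k
  assume "k \<in> matching_sizes P us vs"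
  then obtain I m where I: "k = card I" "I \<subseteq> {..<length us}" "inj_on m I" "m ` I \<subseteq> {..<length vs}"
    "\<forall>i\<in>I. P (us ! i) (vs ! m i)" by (auto simp: matching_sizes_def)
  obtain \<sigma> where \<sigma>: "bij_betw \<sigma> {..<length us} {..<length us'}"
    "\<forall>i<length us. R (us ! i) (us' ! \<sigma> i)" using us by (auto simp: perm_related_def)
  obtain \<tau> where \<tau>: "bij_betw \<tau> {..<length vs} {..<length vs'}"
    "\<forall>i<length vs. S (vs ! i) (vs' ! \<tau> i)" using vs by (auto simp: perm_related_def)
  let ?g = "inv_into {..<length us} \<sigma>"
  have g: "?g (\<sigma> i) = i" if "i \<in> I" for i
    using that I(2) \<sigma>(1) by (intro inv_into_f_f) (auto simp: bij_betw_def)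
  have inj\<sigma>: "inj_on \<sigma> I" using I(2) \<sigma>(1) by (auto simp: bij_betw_def intro: inj_on_subset)
  have inj\<tau>: "inj_on \<tau> (m ` I)" using I(4) \<tau>(1) by (auto simp: bij_betw_def intro: inj_on_subset)
  have "k = card (\<sigma> ` I)" using I(1) card_image[OF inj\<sigma>] by simp
  moreover have "\<sigma> ` I \<subseteq> {..<length us'}" using I(2) \<sigma>(1) by (auto simp: bij_betw_def)
  moreover have "inj_on (\<lambda>j. \<tau> (m (?g j))) (\<sigma> ` I)"
    using inj\<tau> I(3) by (auto simp: inj_on_def g)
  moreover have "(\<lambda>j. \<tau> (m (?g j))) ` (\<sigma> ` I) \<subseteq> {..<length vs'}"
  proof safe
    fix i assume "i \<in> I"
    then show "\<tau> (m (?g (\<sigma> i))) < length vs'"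
      using I(4) bij_betw_apply[OF \<tau>(1), of "m i"] by (auto simp: g)
  qed
  moreover have "\<forall>j\<in>\<sigma> ` I. Q (us' ! j) (vs' ! \<tau> (m (?g j)))"
  proof safe
    fix i assume "i \<in> I"
    then have "i < length us" "m i < length vs" "P (us ! i) (vs ! m i)" using I by auto
    then show "Q (us' ! \<sigma> i) (vs' ! \<tau> (m (?g (\<sigma> i))))"
      using PQ[of "us ! i" "us' ! \<sigma> i" "vs ! m i" "vs' ! \<tau> (m i)"] \<sigma>(2) \<tau>(2) g[OF \<open>i \<in> I\<close>]
      by simp
  qed
  ultimately show "k \<in> matching_sizes Q us' vs'" unfolding matching_sizes_def by blast
qed

text \<open>The common source of all invariance of distances: with \<open>R\<close> association and
  \<open>C = D\<close> it shows independence of representatives, with \<open>R\<close> the relation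
  \<open>lifts\<close> it compares \<open>H\<close> with \<open>T\<close>.\<close>

lemma tuple_dist_cong:
  assumes x: "perm_related R (snd x) (snd x')" and y: "perm_related R (snd y) (snd y')"
    and CD: "\<And>u u' v v'. R u u' \<Longrightarrow> R v v' \<Longrightarrow> assoc_mor C u v \<longleftrightarrow> assoc_mor D u' v'"
  shows "tuple_dist C x y = tuple_dist D x' y'"
proof -
  have "matching_sizes (assoc_mor C) (snd x) (snd y) =
      matching_sizes (assoc_mor D) (snd x') (snd y')"
    using matching_sizes_subset[OF x y, of "assoc_mor C" "assoc_mor D"]
      matching_sizes_subset[OF perm_related_converse[OF x] perm_related_converse[OF y],
        of "assoc_mor D" "assoc_mor C"] CD by blast
  then show ?thesis
    using perm_related_length[OF x] perm_related_length[OF y] by (simp add: tuple_dist_matching)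
qed

lemma tuple_dist_eq_0_iff:
  "tuple_dist C x y = 0 \<longleftrightarrow> perm_related (assoc_mor C) (snd x) (snd y)"
proof -
  let ?us = "snd x" and ?vs = "snd y"
  let ?M = "matching_sizes (assoc_mor C) ?us ?vs"
  have "?M \<subseteq> {..length ?us}"
    by (auto simp: matching_sizes_def dest: card_mono[rotated])
  then have fin: "finite ?M" by (rule finite_subset) simp
  \<comment> \<open>The empty matching is always available, so \<open>Max\<close> is taken over a
    nonempty set.\<close>
  have "card ({}::nat set) \<in> ?M" unfolding matching_sizes_def by blast
  then have ne: "?M \<noteq> {}" by blast
  show ?thesis
  proof
    assume 0: "tuple_dist C x y = 0"
    have "Max ?M \<in> ?M" using fin ne by (rule Max_in)
    then obtain I \<sigma> where I: "Max ?M = card I" "I \<subseteq> {..<length ?us}" "inj_on \<sigma> I"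
      "\<sigma> ` I \<subseteq> {..<length ?vs}" "\<forall>i\<in>I. assoc_mor C (?us ! i) (?vs ! \<sigma> i)"
      unfolding matching_sizes_def by blast
    \<comment> \<open>Subtraction on naturals is truncated: value 0 says that both lengths are at
      most \<open>card I\<close>, which forces a maximal matching to exhaust both lists.\<close>
    have "length ?us \<le> card I" "length ?vs \<le> card I"
      using 0 I(1) by (auto simp: tuple_dist_matching)
    then have "I = {..<length ?us}" "\<sigma> ` I = {..<length ?vs}"
      using I(2,4) card_image[OF I(3)] card_seteq[of "{..<length ?us}" I]
        card_seteq[of "{..<length ?vs}" "\<sigma> ` I"] by simp_all
    then show "perm_related (assoc_mor C) ?us ?vs"
      using I(3,5) by (auto simp: perm_related_def bij_betw_def)
  next
    assume r: "perm_related (assoc_mor C) ?us ?vs"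
    then obtain \<sigma> where "inj_on \<sigma> {..<length ?us}" "\<sigma> ` {..<length ?us} \<subseteq> {..<length ?vs}"
      "\<forall>i\<in>{..<length ?us}. assoc_mor C (?us ! i) (?vs ! \<sigma> i)"
      by (auto simp: perm_related_def bij_betw_def)
    then have "card {..<length ?us} \<in> ?M" unfolding matching_sizes_def by blast
    then have "length ?us \<le> Max ?M" using fin by simp
    then show "tuple_dist C x y = 0"
      using perm_related_length[OF r] by (simp add: tuple_dist_matching)
  qed
qed

section \<open>Factorizations and their representatives\<close>

text \<open>The analogue of \<open>rigid_facts_of\<close> before passing to classes; the
  constructions below are carried out here.\<close>

definition tuples_of :: "'a small_cat \<Rightarrow> 'a \<Rightarrow> 'a fact_tuple set" where
  "tuples_of C a = {x \<in> fact_tuples C. tuple_prod C x = a}"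

context small_category
begin

lemma perm_assoc_sym:
  "perm_related (assoc_mor C) us vs \<Longrightarrow> perm_related (assoc_mor C) vs us"
  by (drule perm_related_converse, erule perm_related_mono) (rule assoc_mor_sym)

lemma perm_assoc_trans:
  "perm_related (assoc_mor C) us vs \<Longrightarrow> perm_related (assoc_mor C) vs ws \<Longrightarrow>
    perm_related (assoc_mor C) us ws"
  by (erule (1) perm_related_compose) (rule assoc_mor_trans)

lemma perm_assoc_refl: "set us \<subseteq> mor C \<Longrightarrow> perm_related (assoc_mor C) us us"
  by (rule perm_relatedI) (auto intro!: assoc_mor_refl)

lemma tuple_dist_perm_assoc:
  assumes "perm_related (assoc_mor C) (snd x) (snd x')" "perm_related (assoc_mor C) (snd y) (snd y')"
  shows "tuple_dist C x y = tuple_dist C x' y'"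
  using assms by (rule tuple_dist_cong) (meson assoc_mor_sym assoc_mor_trans)

lemma fact_tuple_mor: "x \<in> fact_tuples C \<Longrightarrow> set (snd x) \<subseteq> mor C"
  by (auto simp: fact_tuples_def composable_Cons composable_def)

lemma fact_tuple_absorb_left:
  assumes x: "(\<epsilon>, us) \<in> fact_tuples C" and e: "e \<in> units C" "tgt C e = src C \<epsilon>"
  shows "(e \<odot> \<epsilon>, us) \<in> tuples_of C (e \<odot> tuple_prod C (\<epsilon>, us))"
proof -
  have "composable C (e # \<epsilon> # us)" "\<epsilon> \<in> units C"
    using x e by (auto simp: fact_tuples_def composable_Cons unit_simps)
  then have "composable C (e \<odot> \<epsilon> # us)" "e \<odot> \<epsilon> \<in> units C"
    "product C (e \<odot> \<epsilon> # us) = e \<odot> product C (\<epsilon> # us)"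
    using e product_Cons[of e \<epsilon> us]
    by (auto simp: composable_Cons unit_simps cat_simps unit_cmp product_def)
  then show ?thesis using x by (auto simp: tuples_of_def fact_tuples_def tuple_prod_def)
qed

text \<open>There is no slot for a unit on the right, so \<open>h\<close> is merged into the last
  atom, which stays an associated atom. Without atoms it is merged into the leading unit.\<close>

lemma fact_tuple_absorb_right:
  assumes x: "x \<in> fact_tuples C" and h: "h \<in> units C" "tgt C (tuple_prod C x) = src C h"
  obtains y where "y \<in> tuples_of C (tuple_prod C x \<odot> h)"
    "perm_related (assoc_mor C) (snd x) (snd y)"
proof -
  obtain \<epsilon> us where eq: "x = (\<epsilon>, us)" by (cases x)
  have c: "composable C (\<epsilon> # us)" "\<epsilon> \<in> units C" "set us \<subseteq> atoms C"
    using x by (auto simp: fact_tuples_def eq)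
  have t: "tgt C (last (\<epsilon> # us)) = src C h"
    using h product_mor_tgt[OF c(1)] by (simp add: eq tuple_prod_def)
  show ?thesis
  proof (cases us rule: rev_cases)
    case Nil
    have "(\<epsilon> \<odot> h, []) \<in> tuples_of C (tuple_prod C x \<odot> h)"
      using c t h by (simp add: Nil eq tuples_of_def fact_tuples_def tuple_prod_def product_def
          unit_cmp composable_Cons unit_simps cat_simps)
    moreover have "perm_related (assoc_mor C) [] []" by (rule perm_relatedI) simp_all
    ultimately show ?thesis using that[of "(\<epsilon> \<odot> h, [])"] by (simp add: eq Nil)
  next
    case (snoc ws v)
    have v: "v \<in> mor C" "tgt C v = src C h" "v \<in> atoms C" "set ws \<subseteq> atoms C"
      "composable C (\<epsilon> # ws)" "tgt C (last (\<epsilon> # ws)) = src C v"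
      using c t composable_snoc[of "\<epsilon> # ws" v] by (auto simp: snoc)
    have vh: "assoc_mor C v (v \<odot> h)" using v h by (simp add: assoc_mor_right)
    have comp: "composable C (\<epsilon> # ws @ [v \<odot> h])"
      using v h composable_snoc[of "\<epsilon> # ws" "v \<odot> h"] by (simp add: unit_simps cat_simps)
    have p: "product C (\<epsilon> # ws) \<in> mor C" "tgt C (product C (\<epsilon> # ws)) = src C v"
      using product_mor_tgt[OF v(5)] v(6) by auto
    have "product C (\<epsilon> # ws @ [v \<odot> h]) = product C (\<epsilon> # ws @ [v]) \<odot> h"
      using p v h product_snoc[of "\<epsilon> # ws"] by (simp add: cmp_assoc unit_simps)
    then have 1: "(\<epsilon>, ws @ [v \<odot> h]) \<in> tuples_of C (tuple_prod C x \<odot> h)"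
      using comp v c(2) atom_assoc[OF v(3) vh]
      by (simp add: tuples_of_def fact_tuples_def tuple_prod_def eq snoc)
    have "assoc_mor C ((ws @ [v]) ! i) ((ws @ [v \<odot> h]) ! i)" if "i < length (ws @ [v])" for i
    proof (cases "i < length ws")
      case True
      then show ?thesis using v(4) by (auto simp: nth_append intro!: assoc_mor_refl atom_mor)
    next
      case False
      with that have "i = length ws" by simp
      then show ?thesis using vh by simp
    qed
    then have "perm_related (assoc_mor C) (snd x) (ws @ [v \<odot> h])"
      unfolding eq snoc snd_conv by (intro perm_relatedI) simp_all
    then show ?thesis using that 1 by fastforce
  qed
qed

text \<open>Writing \<open>b = e a h\<close>, the unit \<open>e\<close> goes into the leading unit
  and \<open>h\<close> into the right end. This serves to pass between \<open>\<phi> a\<close> and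
  an arbitrary \<open>b\<close> supplied by (T1).\<close>

lemma tuples_of_assoc:
  assumes x: "x \<in> tuples_of C a" and ab: "assoc_mor C a b"
  obtains y where "y \<in> tuples_of C b" "perm_related (assoc_mor C) (snd x) (snd y)"
proof -
  obtain e h where *: "a \<in> mor C" "e \<in> units C" "h \<in> units C" "tgt C e = src C a"
    "tgt C a = src C h" "b = e \<odot> a \<odot> h" using ab by (rule assoc_morE)
  obtain \<epsilon> us where eq: "x = (\<epsilon>, us)" by (cases x)
  have x': "(\<epsilon>, us) \<in> fact_tuples C" "tuple_prod C (\<epsilon>, us) = a"
    using x by (auto simp: tuples_of_def eq)
  have "src C a = src C \<epsilon>"
    using x' product_mor_tgt[of "\<epsilon> # us"] by (auto simp: fact_tuples_def tuple_prod_def)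
  then have y: "(e \<odot> \<epsilon>, us) \<in> tuples_of C (e \<odot> a)"
    using fact_tuple_absorb_left[OF x'(1), of e] * x' by simp
  then have y': "(e \<odot> \<epsilon>, us) \<in> fact_tuples C" "tuple_prod C (e \<odot> \<epsilon>, us) = e \<odot> a"
    by (auto simp: tuples_of_def)
  have "tgt C (tuple_prod C (e \<odot> \<epsilon>, us)) = src C h"
    using y'(2) * by (simp add: cat_simps unit_simps)
  from fact_tuple_absorb_right[OF y'(1) *(3) this] show ?thesis
    using that * y'(2) by (auto simp: eq)
qed

lemma rigid_rel_refl:
  assumes "x \<in> fact_tuples C"
  shows "(x, x) \<in> rigid_rel C"
proof -
  obtain \<epsilon> us where eq: "x = (\<epsilon>, us)" by (cases x)
  have c: "composable C (\<epsilon> # us)" using assms by (auto simp: fact_tuples_def eq)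
  have m: "us ! i \<in> mor C" if "i < length us" for i
    using fact_tuple_mor[OF assms] that by (auto simp: eq)
  \<comment> \<open>All connecting units are identities: at the source of the atom for inner
    positions, and at the target of the last atom for the final index, where no further atom exists.
    Composability makes both cases agree with \<open>tgt C (us ! i)\<close> at index
    \<open>Suc i\<close>.\<close>
  define \<delta> where "\<delta> = (\<lambda>i. if i < length us then src C (us ! i) else tgt C (last us))"
  have step: "\<delta> (Suc i) = tgt C (us ! i)" if "i < length us" for i
  proof (cases "Suc i < length us")
    case True
    then show ?thesis using composable_nth[OF c, of "Suc i"] by (simp add: \<delta>_def)
  next
    case False
    with that have "i = length us - 1" "us \<noteq> []" by auto
    then show ?thesis using False by (simp add: \<delta>_def last_conv_nth)
  qed
  have inv: "inv_mor C (\<delta> (Suc i)) = tgt C (us ! i)" if "i < length us" for i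
    using that by (simp add: step m inv_mor_eqI inverse_mor_tgt)
  have "\<epsilon> \<odot> us ! 0 = \<epsilon> \<odot> us ! 0 \<odot> inv_mor C (\<delta> 1)" if "us \<noteq> []"
    using c that cmp_tgt_id[of "\<epsilon> \<odot> us ! 0"] inv[of 0]
    by (cases us) (auto simp: composable_Cons cat_simps)
  moreover have "us ! i = \<delta> i \<odot> us ! i \<odot> inv_mor C (\<delta> (Suc i))" if "i \<in> {1..<length us}" for i
    using that inv[of i] m[of i] by (simp add: \<delta>_def cat_simps)
  moreover have "\<forall>i\<in>{1..<length us}. \<delta> i \<in> units C \<and> tgt C (\<delta> i) = src C (us ! i)"
    "\<delta> (length us) = tgt C (last us)"
    by (auto simp: \<delta>_def m src_unit tgt_src)
  ultimately show ?thesis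
    using assms unfolding rigid_rel_def eq by (auto intro!: exI[of _ \<delta>])
qed

text \<open>Inner atoms are associated through the connecting units directly. The first one is only
  controlled together with its leading unit, so \<open>\<epsilon>'\<close> has to be inverted.
  Consequently product and distance are constant on rigid classes.\<close>

lemma rigid_relD:
  assumes "(x, y) \<in> rigid_rel C"
  shows "y \<in> tuples_of C (tuple_prod C x)" "perm_related (assoc_mor C) (snd x) (snd y)"
proof -
  obtain \<epsilon> us \<epsilon>' vs where eq: "x = (\<epsilon>, us)" "y = (\<epsilon>', vs)" by (cases x, cases y)
  have ft: "(\<epsilon>, us) \<in> fact_tuples C" "(\<epsilon>', vs) \<in> fact_tuples C" and
    len: "length us = length vs" and pr: "tuple_prod C (\<epsilon>, us) = tuple_prod C (\<epsilon>', vs)"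
    using assms unfolding eq rigid_rel_def by auto
  show "y \<in> tuples_of C (tuple_prod C x)" using ft pr by (simp add: tuples_of_def eq)
  have "assoc_mor C (us ! i) (vs ! i)" if i: "i < length us" for i
  proof -
    obtain \<delta> where \<delta>: "\<And>i. 1 \<le> i \<Longrightarrow> i < length us \<Longrightarrow> \<delta> i \<in> units C \<and> tgt C (\<delta> i) = src C (us ! i)"
      "\<delta> (length us) = tgt C (last us)"
      "\<epsilon>' \<odot> vs ! 0 = \<epsilon> \<odot> us ! 0 \<odot> inv_mor C (\<delta> 1)"
      "\<And>i. 1 \<le> i \<Longrightarrow> i < length us \<Longrightarrow> vs ! i = \<delta> i \<odot> us ! i \<odot> inv_mor C (\<delta> (Suc i))"
      using assms i unfolding eq rigid_rel_def by fastforce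
    have c: "composable C (\<epsilon> # us)" "\<epsilon> \<in> units C" "composable C (\<epsilon>' # vs)" "\<epsilon>' \<in> units C"
      using ft by (auto simp: fact_tuples_def)
    have m: "us ! j \<in> mor C" "vs ! j \<in> mor C" if "j < length us" for j
      using fact_tuple_mor[OF ft(1)] fact_tuple_mor[OF ft(2)] that len by auto
    have suc: "\<delta> (Suc i) \<in> units C \<and> tgt C (\<delta> (Suc i)) = tgt C (us ! i)"
    proof (cases "Suc i < length us")
      case True
      then show ?thesis using composable_nth[OF c(1), of "Suc i"] \<delta>(1)[of "Suc i"] by simp
    next
      case False
      with i have "Suc i = length us" "us \<noteq> []" by auto
      then show ?thesis using \<delta>(2) m[OF i]
        by (metis last_conv_nth diff_Suc_1 tgt_unit tgt_tgt)
    qed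
    show ?thesis
    proof (cases i)
      case 0
      have h: "tgt C \<epsilon> = src C (us ! 0)" "tgt C \<epsilon>' = src C (vs ! 0)"
        using composable_nth[OF c(1), of 0] composable_nth[OF c(3), of 0] i len by (cases us; cases vs; simp)+
      let ?d = "inv_mor C (\<delta> 1)" and ?e = "inv_mor C \<epsilon>'"
      have d: "?d \<in> units C" "tgt C (us ! 0) = src C ?d" using suc by (simp_all add: 0 unit_simps)
      have m0: "us ! 0 \<in> mor C" "vs ! 0 \<in> mor C" using m i by (simp_all add: 0)
      \<comment> \<open>Comparing sources is what makes the product of
        \<open>inv_mor C \<epsilon>'\<close> and \<open>\<epsilon>\<close> defined.\<close>
      have "src C (\<epsilon>' \<odot> vs ! 0) = src C (\<epsilon> \<odot> us ! 0 \<odot> ?d)" using \<delta>(3) by simp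
      then have s: "src C \<epsilon>' = src C \<epsilon>"
        using c h d m0 by (simp add: cat_simps unit_simps)
      have "vs ! 0 = ?e \<odot> (\<epsilon>' \<odot> vs ! 0)" using c h m0 by (simp add: inv_cmp_cancel)
      also have "\<dots> = (?e \<odot> \<epsilon>) \<odot> us ! 0 \<odot> ?d"
        using \<delta>(3) c h d m0 s by (simp add: cmp_assoc cat_simps unit_simps)
      finally show ?thesis
        using assoc_morI[of "us ! 0" "?e \<odot> \<epsilon>" ?d] c h d m0 s
        by (simp add: 0 unit_cmp unit_simps cat_simps)
    next
      case (Suc j)
      then show ?thesis
        using assoc_morI[of "us ! i" "\<delta> i" "inv_mor C (\<delta> (Suc i))"] \<delta>(1)[of i] \<delta>(4)[of i] suc m i
        by (simp add: unit_simps)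
    qed
  qed
  then show "perm_related (assoc_mor C) (snd x) (snd y)"
    using len by (auto simp: eq intro: perm_relatedI)
qed

section \<open>Passage from tuples to rigid and permutable classes\<close>

lemma rigid_class_iff: "y \<in> rigid_class C x \<longleftrightarrow> (x, y) \<in> rigid_rel C"
  by (simp add: rigid_class_def)

lemma rigid_facts_eq: "rigid_facts C = rigid_class C ` fact_tuples C"
  by (auto simp: rigid_facts_def quotient_def rigid_class_def)

lemma rigid_prod_class:
  assumes "x \<in> fact_tuples C"
  shows "rigid_prod C (rigid_class C x) = tuple_prod C x"
  unfolding rigid_prod_def
proof (rule the_elem_image_unique)
  show "rigid_class C x \<noteq> {}"
    using rigid_rel_refl[OF assms] unfolding rigid_class_iff[symmetric] by blast
next
  fix y assume "y \<in> rigid_class C x"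
  then show "tuple_prod C y = tuple_prod C x"
    using rigid_relD(1)[of x y] by (simp add: rigid_class_iff tuples_of_def)
qed

lemma rigid_dist_class:
  assumes "x \<in> fact_tuples C" "y \<in> fact_tuples C"
  shows "rigid_dist C (rigid_class C x) (rigid_class C y) = tuple_dist C x y"
proof -
  have "the_elem ((\<lambda>(x, y). tuple_dist C x y) ` (rigid_class C x \<times> rigid_class C y)) =
      (\<lambda>(x, y). tuple_dist C x y) (x, y)"
  proof (rule the_elem_image_unique)
    show "rigid_class C x \<times> rigid_class C y \<noteq> {}"
      using assms[THEN rigid_rel_refl] unfolding rigid_class_iff[symmetric] by blast
  next
    fix p assume "p \<in> rigid_class C x \<times> rigid_class C y"
    then show "(\<lambda>(x, y). tuple_dist C x y) p = (\<lambda>(x, y). tuple_dist C x y) (x, y)"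
      by (auto simp: rigid_class_iff dest!: rigid_relD(2) intro!: tuple_dist_perm_assoc[symmetric])
  qed
  then show ?thesis by (simp add: rigid_dist_def)
qed

lemma rigid_facts_of_eq: "rigid_facts_of C a = rigid_class C ` tuples_of C a"
  by (auto simp: rigid_facts_of_def rigid_facts_eq tuples_of_def rigid_prod_class)

lemma rigid_dist_self: "z \<in> rigid_facts_of C a \<Longrightarrow> rigid_dist C z z = 0"
  using perm_assoc_refl[OF fact_tuple_mor]
  by (force simp: rigid_facts_of_eq tuples_of_def rigid_dist_class tuple_dist_eq_0_iff)

text \<open>Distance 0 means a full matching of associated atoms, so membership in a permutable
  class becomes a condition on representing tuples.\<close>

lemma perm_class_eq:
  assumes "x \<in> fact_tuples C"
  shows "perm_class C (rigid_class C x) = rigid_class C `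
    {y \<in> tuples_of C (tuple_prod C x). perm_related (assoc_mor C) (snd x) (snd y)}"
  using assms
  by (auto simp: perm_class_def perm_rel_def rigid_facts_eq rigid_prod_class rigid_dist_class
      tuple_dist_eq_0_iff tuples_of_def)

lemma perm_class_cong:
  assumes "x \<in> fact_tuples C" "y \<in> tuples_of C (tuple_prod C x)"
    "perm_related (assoc_mor C) (snd x) (snd y)"
  shows "perm_class C (rigid_class C y) = perm_class C (rigid_class C x)"
proof -
  have "perm_related (assoc_mor C) (snd y) us \<longleftrightarrow> perm_related (assoc_mor C) (snd x) us" for us
    using assms(3) perm_assoc_sym perm_assoc_trans by blast
  then show ?thesis using assms by (simp add: perm_class_eq tuples_of_def)
qed

lemma perm_dist_class:
  assumes "x \<in> fact_tuples C" "y \<in> fact_tuples C"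
  shows "perm_dist C (perm_class C (rigid_class C x)) (perm_class C (rigid_class C y)) =
    tuple_dist C x y"
proof -
  let ?X = "perm_class C (rigid_class C x)" and ?Y = "perm_class C (rigid_class C y)"
  have "the_elem ((\<lambda>(z, z'). rigid_dist C z z') ` (?X \<times> ?Y)) =
      (\<lambda>(z, z'). rigid_dist C z z') (rigid_class C x, rigid_class C y)"
  proof (rule the_elem_image_unique)
    show "?X \<times> ?Y \<noteq> {}"
      using assms assms[THEN fact_tuple_mor, THEN perm_assoc_refl]
      unfolding perm_class_eq[OF assms(1)] perm_class_eq[OF assms(2)] tuples_of_def by blast
  next
    fix p assume "p \<in> ?X \<times> ?Y"
    then show "(\<lambda>(z, z'). rigid_dist C z z') p =
        (\<lambda>(z, z'). rigid_dist C z z') (rigid_class C x, rigid_class C y)"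
      using assms by (auto simp: perm_class_eq tuples_of_def rigid_dist_class
          intro!: tuple_dist_perm_assoc[symmetric])
  qed
  then show ?thesis using assms by (simp add: perm_dist_def rigid_dist_class)
qed

lemma perm_class_self:
  assumes "x \<in> fact_tuples C"
  shows "x \<in> \<Union>(perm_class C (rigid_class C x))"
proof -
  have "rigid_class C x \<in> perm_class C (rigid_class C x)"
    unfolding perm_class_eq[OF assms] using assms perm_assoc_refl[OF fact_tuple_mor[OF assms]]
    by (intro imageI) (simp add: tuples_of_def)
  moreover have "x \<in> rigid_class C x"
    using rigid_rel_refl[OF assms] by (simp only: rigid_class_iff)
  ultimately show ?thesis by blast
qed

text \<open>A tuple in the union sits in the rigid class of some \<open>x'\<close>, whose own class
  lies in the permutable class of \<open>x\<close>; the matchings from the two layers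
  compose.\<close>

lemma perm_class_representative:
  assumes "x \<in> fact_tuples C" "y \<in> \<Union>(perm_class C (rigid_class C x))"
  shows "y \<in> tuples_of C (tuple_prod C x)" "perm_related (assoc_mor C) (snd x) (snd y)"
proof -
  obtain x' where x': "x' \<in> tuples_of C (tuple_prod C x)"
    "perm_related (assoc_mor C) (snd x) (snd x')" "y \<in> rigid_class C x'"
    using assms(2) unfolding perm_class_eq[OF assms(1)] by blast
  have r: "(x', y) \<in> rigid_rel C" using x'(3) by (simp only: rigid_class_iff)
  show "y \<in> tuples_of C (tuple_prod C x)"
    using rigid_relD(1)[OF r] x'(1) by (simp add: tuples_of_def)
  show "perm_related (assoc_mor C) (snd x) (snd y)"
    using x'(2) rigid_relD(2)[OF r] by (rule perm_assoc_trans)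
qed

end

section \<open>Catenary degrees\<close>

definition dist_graph :: "'a small_cat \<Rightarrow> 'a \<Rightarrow> enat \<Rightarrow> ('a rigid_fact \<times> 'a rigid_fact) set" where
  "dist_graph C a N = {(z, z'). z \<in> rigid_facts_of C a \<and> z' \<in> rigid_facts_of C a \<and>
     enat (rigid_dist C z z') \<le> N}"

definition chain_bound :: "'a small_cat \<Rightarrow> 'a \<Rightarrow> enat \<Rightarrow> bool" where
  "chain_bound C a N \<longleftrightarrow>
     (\<forall>z\<in>rigid_facts_of C a. \<forall>z'\<in>rigid_facts_of C a. (z, z') \<in> (dist_graph C a N)\<^sup>*)"

text \<open>The hypothesis on \<open>z\<close> covers chains of length 0: reflexive closure relates
  every element to itself, while a chain must also consist of factorizations of
  \<open>a\<close>.\<close>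

lemma chain_iff_rtrancl:
  assumes "z \<in> rigid_facts_of C a"
  shows "(\<exists>(n :: nat) (c :: nat \<Rightarrow> 'a rigid_fact). c 0 = z \<and> c n = z' \<and>
       (\<forall>i\<in>{0..n}. c i \<in> rigid_facts_of C a) \<and>
       (\<forall>i\<in>{1..n}. enat (rigid_dist C (c (i - 1)) (c i)) \<le> N)) \<longleftrightarrow>
     (z, z') \<in> (dist_graph C a N)\<^sup>*" (is "?L \<longleftrightarrow> ?R")
proof
  assume ?L
  then obtain n :: nat and c :: "nat \<Rightarrow> 'a rigid_fact" where c: "c 0 = z" "c n = z'"
    "\<And>i. i \<le> n \<Longrightarrow> c i \<in> rigid_facts_of C a"
    "\<And>i. 1 \<le> i \<Longrightarrow> i \<le> n \<Longrightarrow> enat (rigid_dist C (c (i - 1)) (c i)) \<le> N" by auto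
  have "\<forall>i<n. (c i, c (Suc i)) \<in> dist_graph C a N"
    using c(3) c(4)[of "Suc i" for i] by (auto simp: dist_graph_def)
  then have "(z, z') \<in> dist_graph C a N ^^ n" using c(1,2) by (auto simp: relpow_fun_conv)
  then show ?R by (rule relpow_imp_rtrancl)
next
  assume ?R
  then obtain n where "(z, z') \<in> dist_graph C a N ^^ n" by (auto dest: rtrancl_imp_relpow)
  then obtain c where c: "c 0 = z" "c n = z'" "\<And>i. i < n \<Longrightarrow> (c i, c (Suc i)) \<in> dist_graph C a N"
    by (auto simp: relpow_fun_conv)
  have "c i \<in> rigid_facts_of C a" if "i \<le> n" for i
    using that assms c(1) c(3)[of "i - 1"] by (cases i) (auto simp: dist_graph_def)
  moreover have "enat (rigid_dist C (c (i - 1)) (c i)) \<le> N" if "i \<in> {1..n}" for i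
    using that c(3)[of "i - 1"] by (auto simp: dist_graph_def)
  ultimately show ?L using c(1,2) by (intro exI[of _ n] exI[of _ c]) auto
qed

lemma perm_catenary_of_eq: "perm_catenary_of C a = (LEAST N. chain_bound C a N)"
  unfolding perm_catenary_of_def chain_bound_def
  by (intro arg_cong[of _ _ Least] ext ball_cong refl chain_iff_rtrancl)

text \<open>The correspondence \<open>S\<close> is total and surjective but may be many-to-many. A
  chain is moved by choosing a partner for each intermediate vertex; one-sidedness is no loss, as
  the lemma also applies to the converse of \<open>S\<close>.\<close>

lemma chain_bound_transfer:
  assumes tot: "\<And>z. z \<in> rigid_facts_of C a \<Longrightarrow> \<exists>w. S z w"
    and surj: "\<And>w. w \<in> rigid_facts_of D b \<Longrightarrow> \<exists>z. S z w"
    and mem: "\<And>z w. S z w \<Longrightarrow> z \<in> rigid_facts_of C a \<and> w \<in> rigid_facts_of D b"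
    and dist: "\<And>z w z' w'. S z w \<Longrightarrow> S z' w' \<Longrightarrow> rigid_dist C z z' = rigid_dist D w w'"
    and self: "\<And>z. z \<in> rigid_facts_of C a \<Longrightarrow> rigid_dist C z z = 0"
    and bound: "chain_bound C a N"
  shows "chain_bound D b N"
  unfolding chain_bound_def
proof (intro ballI)
  have edge: "(w, w') \<in> dist_graph D b N"
    if "S z w" "S z' w'" "enat (rigid_dist C z z') \<le> N" for z z' w w'
    using that mem[OF that(1)] mem[OF that(2)] dist[OF that(1,2)] by (simp add: dist_graph_def)
  have chain: "S z' w' \<longrightarrow> (w, w') \<in> (dist_graph D b N)\<^sup>*"
    if "(z, z') \<in> (dist_graph C a N)\<^sup>*" "S z w" for z z' w w'
    using that(1)
  proof (induction arbitrary: w' rule: rtrancl_induct)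
    case base
    show ?case
    proof
      assume "S z w'"
      \<comment> \<open>Here \<open>w\<close> and \<open>w'\<close> are two partners of the same
        \<open>z\<close>; their distance equals that of \<open>z\<close> to itself, namely 0, so
        they are joined by an edge for every \<open>N\<close>.\<close>
      then have "(w, w') \<in> dist_graph D b N"
        using that(2) mem self edge[of z w z w'] by (simp flip: zero_enat_def)
      then show "(w, w') \<in> (dist_graph D b N)\<^sup>*" by blast
    qed
  next
    case (step y z')
    show ?case
    proof
      assume z': "S z' w'"
      from step.hyps(2) have y: "y \<in> rigid_facts_of C a" "enat (rigid_dist C y z') \<le> N"
        by (auto simp: dist_graph_def)
      obtain v where v: "S y v" using tot y(1) by blast
      then have "(w, v) \<in> (dist_graph D b N)\<^sup>*" using step.IH by blast
      moreover have "(v, w') \<in> dist_graph D b N" using v z' y(2) by (rule edge)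
      ultimately show "(w, w') \<in> (dist_graph D b N)\<^sup>*" by (rule rtrancl_into_rtrancl)
    qed
  qed
  fix w w'
  assume "w \<in> rigid_facts_of D b" "w' \<in> rigid_facts_of D b"
  then obtain z z' where z: "S z w" "S z' w'" using surj by blast
  then have "(z, z') \<in> (dist_graph C a N)\<^sup>*" using mem bound by (auto simp: chain_bound_def)
  then show "(w, w') \<in> (dist_graph D b N)\<^sup>*" using chain z by blast
qed

section \<open>Isoatomic weak transfer homomorphisms\<close>

locale isoatomic_weak_transfer =
  H: cancellative_category H + T: cancellative_category T
  for H :: "'a small_cat" and T :: "'b small_cat" +
  fixes \<phi> :: "'a \<Rightarrow> 'b"
  assumes atomic_T: "atomic T"
    and weak_transfer: "weak_transfer_hom H T \<phi>"
    and isoatomic: "isoatomic H T \<phi>"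
begin

section \<open>Images of units, products and atoms\<close>

lemma hom_mor: "a \<in> mor H \<Longrightarrow> \<phi> a \<in> mor T"
  and hom_src: "a \<in> mor H \<Longrightarrow> src T (\<phi> a) = \<phi> (src H a)"
  and hom_tgt: "a \<in> mor H \<Longrightarrow> tgt T (\<phi> a) = \<phi> (tgt H a)"
  and hom_cmp: "a \<in> mor H \<Longrightarrow> b \<in> mor H \<Longrightarrow> tgt H a = src H b \<Longrightarrow>
    \<phi> (a \<odot>\<^bsub>H\<^esub> b) = \<phi> a \<odot>\<^bsub>T\<^esub> \<phi> b"
  using weak_transfer by (auto simp: weak_transfer_hom_def is_functor_def)

lemmas hom_simps = hom_mor hom_src hom_tgt hom_cmp

lemma hom_unit_iff: "a \<in> mor H \<Longrightarrow> \<phi> a \<in> units T \<longleftrightarrow> a \<in> units H"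
  using weak_transfer by (auto simp: weak_transfer_hom_def transfer_T1_def)

lemma hom_assoc:
  assumes "assoc_mor H u v"
  shows "assoc_mor T (\<phi> u) (\<phi> v)"
proof -
  obtain e h where "u \<in> mor H" "v \<in> mor H" "e \<in> units H" "h \<in> units H" "tgt H e = src H u"
    "tgt H u = src H h" "v = e \<odot>\<^bsub>H\<^esub> u \<odot>\<^bsub>H\<^esub> h" using assms by (rule H.assoc_morE)
  then show ?thesis using T.assoc_morI[of "\<phi> u" "\<phi> e" "\<phi> h"]
    by (simp add: hom_simps hom_unit_iff H.unit_mor H.cat_simps)
qed

lemma hom_product:
  assumes "composable H as" "as \<noteq> []"
  shows "composable T (map \<phi> as) \<and> product T (map \<phi> as) = \<phi> (product H as)"
  using assms
proof (induction as)
  case (Cons a as)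
  show ?case
  proof (cases as)
    case Nil
    then show ?thesis using Cons.prems
      by (simp add: product_def H.composable_Cons T.composable_Cons hom_mor composable_def)
  next
    case (Cons b bs)
    have c: "composable H (a # b # bs)" using Cons.prems Cons by simp
    then have m: "a \<in> mor H" "b \<in> mor H" "tgt H a = src H b" "composable H (b # bs)"
      by (auto simp: H.composable_Cons)
    have IH: "composable T (map \<phi> (b # bs))" "product T (map \<phi> (b # bs)) = \<phi> (product H (b # bs))"
      using Cons.IH m Cons by auto
    have cT: "composable T (\<phi> a # \<phi> b # map \<phi> bs)"
      using IH(1) m hom_src[of b] hom_tgt[of a] by (simp add: T.composable_Cons[of "\<phi> a"] hom_mor)
    have p: "product H (b # bs) \<in> mor H" "src H (product H (b # bs)) = src H b"
      using H.product_mor_tgt[OF m(4)] by auto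
    show ?thesis using cT T.product_Cons[OF cT] H.product_Cons[OF c] IH(2) m p
      by (simp add: Cons hom_cmp)
  qed
qed simp

text \<open>An atomic factorization of the image lifts by (WT2) to one of the same length of the atom.\<close>

lemma hom_atom:
  assumes u: "u \<in> atoms H"
  shows "\<phi> u \<in> atoms T"
proof -
  have um: "u \<in> mor H" "u \<notin> units H" using u by (auto simp: atoms_def)
  then have "\<phi> u \<in> mor T - units T" by (simp add: hom_mor hom_unit_iff)
  then obtain vs where vs: "vs \<noteq> []" "set vs \<subseteq> atoms T" "composable T vs" "\<phi> u = product T vs"
    using atomic_T unfolding atomic_def by blast
  then obtain us where us: "length us = length vs" "set us \<subseteq> atoms H" "composable H us"
    "u = product H us"
    using weak_transfer um unfolding weak_transfer_hom_def transfer_WT2_def by meson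
  have "length us = 1"
  proof (rule ccontr)
    assume "length us \<noteq> 1"
    with us(1) vs(1) obtain a b cs where abc: "us = a # b # cs"
      by (cases us; cases "tl us") auto
    have c: "composable H (a # b # cs)" using us(3) abc by simp
    have m: "a \<in> mor H" "b \<in> mor H" "tgt H a = src H b" "composable H (b # cs)"
      using c by (auto simp: H.composable_Cons)
    have p: "product H (b # cs) \<in> mor H" "src H (product H (b # cs)) = src H b"
      using H.product_mor_tgt[OF m(4)] by auto
    have nu: "a \<notin> units H" "b \<notin> units H" using us(2) abc by (auto simp: atoms_def)
    have "u = a \<odot>\<^bsub>H\<^esub> product H (b # cs)" using us(4) H.product_Cons[OF c] abc by simp
    \<comment> \<open>As \<open>u\<close> is an atom and \<open>a\<close> is not a unit, the rest of
      the product must be a unit; cancellativity then makes its first factor \<open>b\<close> a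
      unit, contradicting that \<open>b\<close> is an atom.\<close>
    then have pu: "product H (b # cs) \<in> units H"
      using u m p nu unfolding atoms_def by auto
    have "b \<in> units H"
    proof (cases cs)
      case Nil
      then show ?thesis using pu by (simp add: product_def)
    next
      case (Cons d ds)
      have "product H (d # ds) \<in> mor H" "src H (product H (d # ds)) = src H d" "tgt H b = src H d"
        using H.product_mor_tgt[of "d # ds"] m(4) by (auto simp: Cons H.composable_Cons[of b])
      then show ?thesis
        using H.left_factor_unit[of b "product H (d # ds)"] pu m H.product_Cons[of b d ds]
        by (simp add: Cons)
    qed
    then show False using nu by simp
  qed
  with us(1) obtain v where "vs = [v]" by (cases vs) auto
  then show ?thesis using vs by (simp add: product_def)
qed

lemma hom_tuple:
  assumes "x \<in> fact_tuples H"
  shows "map_prod \<phi> (map \<phi>) x \<in> tuples_of T (\<phi> (tuple_prod H x))"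
proof -
  obtain \<epsilon> us where eq: "x = (\<epsilon>, us)" by (cases x)
  have c: "\<epsilon> \<in> units H" "set us \<subseteq> atoms H" "composable H (\<epsilon> # us)"
    using assms by (auto simp: fact_tuples_def eq)
  then show ?thesis using hom_product[OF c(3)] hom_atom
    by (auto simp: eq tuples_of_def fact_tuples_def tuple_prod_def hom_unit_iff H.unit_mor)
qed

text \<open>Requiring \<open>u\<close> to be an atom is what makes isoatomicity applicable.\<close>

definition lifts :: "'a \<Rightarrow> 'b \<Rightarrow> bool" where
  "lifts u v \<longleftrightarrow> u \<in> atoms H \<and> assoc_mor T (\<phi> u) v"

text \<open>Isoatomicity reflects association and functoriality preserves it; replacing the images
  by the associated \<open>v\<close> and \<open>v'\<close> changes nothing. This is the
  compatibility that \<open>tuple_dist_cong\<close> asks for.\<close>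

lemma lifts_assoc:
  assumes "lifts u v" "lifts u' v'"
  shows "assoc_mor H u u' \<longleftrightarrow> assoc_mor T v v'"
proof -
  have "assoc_mor H u u' \<longleftrightarrow> assoc_mor T (\<phi> u) (\<phi> u')"
    using assms isoatomic hom_assoc by (auto simp: lifts_def isoatomic_def)
  also have "\<dots> \<longleftrightarrow> assoc_mor T v v'"
    using assms unfolding lifts_def by (meson T.assoc_mor_sym T.assoc_mor_trans)
  finally show ?thesis .
qed

lemma lifts_hom_tuple:
  assumes "x \<in> fact_tuples H"
  shows "perm_related lifts (snd x) (snd (map_prod \<phi> (map \<phi>) x))"
proof (rule perm_relatedI)
  fix i assume "i < length (snd x)"
  moreover from this have "snd x ! i \<in> atoms H" using assms by (auto simp: fact_tuples_def)
  ultimately show "lifts (snd x ! i) (snd (map_prod \<phi> (map \<phi>) x) ! i)"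
    by (simp add: lifts_def T.assoc_mor_refl hom_mor H.atom_mor)
qed simp

lemma tuple_dist_lifts:
  assumes "perm_related lifts (snd x) (snd x')" "perm_related lifts (snd y) (snd y')"
  shows "tuple_dist H x y = tuple_dist T x' y'"
  using assms by (rule tuple_dist_cong) (rule lifts_assoc)

text \<open>Well-definedness of the extension: representatives of one class have equal products and
  distance 0, and both facts persist under \<open>\<phi>\<close>.\<close>

lemma perm_extension_class:
  assumes x: "x \<in> fact_tuples H"
  shows "perm_extension T \<phi> (perm_class H (rigid_class H x)) =
    perm_class T (rigid_class T (map_prod \<phi> (map \<phi>) x))"
proof -
  let ?f = "\<lambda>(\<epsilon>, us). perm_class T (rigid_class T (\<phi> \<epsilon>, map \<phi> us))"
  have f: "?f y = perm_class T (rigid_class T (map_prod \<phi> (map \<phi>) y))" for y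
    by (simp split: prod.split)
  have "the_elem (?f ` \<Union>(perm_class H (rigid_class H x))) = ?f x"
  proof (rule the_elem_image_unique)
    show "\<Union>(perm_class H (rigid_class H x)) \<noteq> {}" using H.perm_class_self[OF x] by blast
  next
    fix y assume "y \<in> \<Union>(perm_class H (rigid_class H x))"
    from H.perm_class_representative[OF x this]
    have y: "y \<in> fact_tuples H" "tuple_prod H y = tuple_prod H x"
      "perm_related (assoc_mor H) (snd x) (snd y)" by (auto simp: tuples_of_def)
    \<comment> \<open>The full matching is carried to \<open>T\<close> by way of the already
      established equality of distances.\<close>
    have "tuple_dist H x y = 0" using y(3) by (simp add: tuple_dist_eq_0_iff)
    then have r: "perm_related (assoc_mor T) (snd (map_prod \<phi> (map \<phi>) x))
        (snd (map_prod \<phi> (map \<phi>) y))"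
      unfolding tuple_dist_lifts[OF lifts_hom_tuple[OF x] lifts_hom_tuple[OF y(1)]]
        tuple_dist_eq_0_iff .
    show "?f y = ?f x"
      unfolding f using hom_tuple[OF x] hom_tuple[OF y(1)] y(2)
      by (intro T.perm_class_cong r) (auto simp: tuples_of_def)
  qed
  then show ?thesis by (simp only: perm_extension_def f)
qed

lemma perm_dist_hom:
  assumes "z \<in> perm_facts_of H a" "z' \<in> perm_facts_of H a"
  shows "perm_dist H z z' = perm_dist T (perm_extension T \<phi> z) (perm_extension T \<phi> z')"
proof -
  obtain x x' where x: "x \<in> fact_tuples H" "x' \<in> fact_tuples H"
    "z = perm_class H (rigid_class H x)" "z' = perm_class H (rigid_class H x')"
    using assms by (auto simp: perm_facts_of_def H.rigid_facts_of_eq tuples_of_def)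
  have "map_prod \<phi> (map \<phi>) x \<in> fact_tuples T" "map_prod \<phi> (map \<phi>) x' \<in> fact_tuples T"
    using x(1,2)[THEN hom_tuple] by (auto simp: tuples_of_def)
  then show ?thesis using x tuple_dist_lifts[OF lifts_hom_tuple lifts_hom_tuple]
    by (simp add: perm_extension_class H.perm_dist_class T.perm_dist_class)
qed

text \<open>(WT2) accepts only nonempty products of atoms, so the leading unit is first merged into
  the first atom. With no atoms, \<open>\<phi> a\<close> is a unit, hence so is \<open>a\<close>,
  and \<open>a\<close> is its own factorization.\<close>

lemma hom_factorization_lift:
  assumes a: "a \<in> mor H" and y: "y \<in> tuples_of T (\<phi> a)"
  obtains x where "x \<in> tuples_of H a" "perm_related lifts (snd x) (snd y)"
proof -
  obtain \<eta> vs where eq: "y = (\<eta>, vs)" by (cases y)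
  have c: "\<eta> \<in> units T" "set vs \<subseteq> atoms T" "composable T (\<eta> # vs)" "\<phi> a = product T (\<eta> # vs)"
    using y by (auto simp: tuples_of_def fact_tuples_def tuple_prod_def eq)
  show ?thesis
  proof (cases vs)
    case Nil
    then have "a \<in> units H" using c a hom_unit_iff[OF a] by (simp add: product_def)
    then have "(a, []) \<in> tuples_of H a"
      using a by (simp add: tuples_of_def fact_tuples_def tuple_prod_def product_def composable_def)
    moreover have "perm_related lifts [] []" by (rule perm_relatedI) simp_all
    ultimately show ?thesis using that[of "(a, [])"] by (simp add: eq Nil)
  next
    case (Cons v ws)
    have m: "\<eta> \<in> mor T" "v \<in> mor T" "tgt T \<eta> = src T v" "v \<in> atoms T" "composable T (v # ws)"
      using c by (auto simp: Cons T.composable_Cons)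
    define vs' where "vs' = (\<eta> \<odot>\<^bsub>T\<^esub> v) # ws"
    have v': "assoc_mor T v (\<eta> \<odot>\<^bsub>T\<^esub> v)" using m c by (simp add: T.assoc_mor_left)
    have vs': "vs' \<noteq> []" "set vs' \<subseteq> atoms T" "composable T vs'" "\<phi> a = product T vs'"
      using c m T.atom_assoc[OF m(4) v']
      by (auto simp: vs'_def Cons T.composable_Cons T.cat_simps product_def)
    obtain us \<sigma> where us: "length us = length vs'" "set us \<subseteq> atoms H" "composable H us"
      "a = product H us" "\<sigma> permutes {..<length vs'}"
      "\<forall>i<length vs'. assoc_mor T (\<phi> (us ! i)) (vs' ! \<sigma> i)"
      using weak_transfer a vs' unfolding weak_transfer_hom_def transfer_WT2_def by meson
    have ne: "us \<noteq> []" using us(1) vs'(1) by auto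
    have "perm_related lifts us vs'"
      unfolding perm_related_def lifts_def
      using us(1,2,6) permutes_imp_bij[OF us(5)] by (intro exI[of _ \<sigma>]) auto
    moreover have "perm_related (\<lambda>v' v. assoc_mor T v' v) vs' vs"
    proof (rule perm_relatedI)
      fix i assume "i < length vs'"
      then show "assoc_mor T (vs' ! i) (vs ! i)"
        using T.assoc_mor_sym[OF v'] c(2)
        by (cases i) (auto simp: vs'_def Cons intro!: T.assoc_mor_refl T.atom_mor)
    qed (simp add: vs'_def Cons)
    ultimately have r: "perm_related lifts us vs"
      by (rule perm_related_compose) (auto simp: lifts_def intro: T.assoc_mor_trans)
    \<comment> \<open>The lifted atoms multiply to \<open>a\<close> exactly, so the identity at the
      source of \<open>a\<close> serves as the leading unit.\<close>
    have p: "src H a = src H (hd us)" using H.product_mor_tgt[OF us(3) ne] us(4) by simp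
    then have ca: "composable H (src H a # us)"
      using us(3) H.src_mor[OF a] H.tgt_src[OF a] by (simp add: H.composable_Cons)
    have "product H (src H a # us) = a"
    proof (cases us)
      case (Cons b bs)
      then show ?thesis using H.product_Cons[of "src H a" b bs] ca us(4) a
        by (simp add: H.cat_simps)
    qed (use ne in simp)
    then have "(src H a, us) \<in> tuples_of H a"
      using ca us(2) a by (simp add: tuples_of_def fact_tuples_def tuple_prod_def H.src_unit)
    then show ?thesis using that[of "(src H a, us)"] r by (simp add: eq)
  qed
qed

lemma perm_catenary_of_hom:
  assumes a: "a \<in> mor H" and ab: "assoc_mor T (\<phi> a) b"
  shows "perm_catenary_of H a = perm_catenary_of T b"
proof -
  \<comment> \<open>Partners are factorizations of \<open>a\<close> and \<open>b\<close> having
    representatives whose atoms correspond, in some order, under \<open>lifts\<close>; leading units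
    are ignored because distances do not see them.\<close>
  define S where "S z w \<longleftrightarrow> (\<exists>x\<in>tuples_of H a. \<exists>y\<in>tuples_of T b. z = rigid_class H x \<and>
    w = rigid_class T y \<and> perm_related lifts (snd x) (snd y))" for z w
  have tot: "\<exists>w. S z w" if z: "z \<in> rigid_facts_of H a" for z
  proof -
    obtain x where x: "x \<in> fact_tuples H" "x \<in> tuples_of H a" "tuple_prod H x = a"
      "z = rigid_class H x"
      using z unfolding H.rigid_facts_of_eq tuples_of_def by blast
    obtain y where y: "y \<in> tuples_of T b"
      "perm_related (assoc_mor T) (snd (map_prod \<phi> (map \<phi>) x)) (snd y)"
      using T.tuples_of_assoc[OF _ ab] hom_tuple[OF x(1)] x(3) by metis
    have "perm_related lifts (snd x) (snd y)"
      using lifts_hom_tuple[OF x(1)] y(2)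
      by (rule perm_related_compose) (auto simp: lifts_def intro: T.assoc_mor_trans)
    then show ?thesis using x y unfolding S_def by blast
  qed
  have surj: "\<exists>z. S z w" if w: "w \<in> rigid_facts_of T b" for w
  proof -
    obtain y where y: "y \<in> tuples_of T b" "w = rigid_class T y"
      using w unfolding T.rigid_facts_of_eq by blast
    \<comment> \<open>(WT2) concerns factorizations of \<open>\<phi> a\<close> itself, so a
      factorization of \<open>b\<close> is first carried over to one of \<open>\<phi> a\<close> with
      associated atoms.\<close>
    obtain y' where y': "y' \<in> tuples_of T (\<phi> a)" "perm_related (assoc_mor T) (snd y) (snd y')"
      using T.tuples_of_assoc[OF y(1) T.assoc_mor_sym[OF ab]] by blast
    obtain x where x: "x \<in> tuples_of H a" "perm_related lifts (snd x) (snd y')"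
      using hom_factorization_lift[OF a y'(1)] by blast
    have "perm_related lifts (snd x) (snd y)"
      using x(2) T.perm_assoc_sym[OF y'(2)]
      by (rule perm_related_compose) (auto simp: lifts_def intro: T.assoc_mor_trans)
    then show ?thesis using x y unfolding S_def by blast
  qed
  have mem: "z \<in> rigid_facts_of H a \<and> w \<in> rigid_facts_of T b" if "S z w" for z w
    using that by (auto simp: S_def H.rigid_facts_of_eq T.rigid_facts_of_eq)
  have dist: "rigid_dist H z z' = rigid_dist T w w'" if "S z w" "S z' w'" for z w z' w'
    using that tuple_dist_lifts
    by (auto simp: S_def tuples_of_def H.rigid_dist_class T.rigid_dist_class)
  have "chain_bound H a N \<longleftrightarrow> chain_bound T b N" for N
  proof
    show "chain_bound H a N \<Longrightarrow> chain_bound T b N"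
      by (rule chain_bound_transfer[of H a S T b]) (use tot surj mem dist H.rigid_dist_self in auto)
    show "chain_bound T b N \<Longrightarrow> chain_bound H a N"
      by (rule chain_bound_transfer[of T b "\<lambda>w z. S z w" H a])
        (use tot surj mem dist T.rigid_dist_self in auto)
  qed
  then show ?thesis by (simp add: perm_catenary_of_eq)
qed

text \<open>The two suprema run over the same set of values: \<open>a\<close> shares its degree with
  \<open>\<phi> a\<close>, and by (T1) every \<open>b\<close> is associated to some
  \<open>\<phi> a\<close>.\<close>

lemma perm_catenary_hom: "perm_catenary H = perm_catenary T"
proof -
  have "perm_catenary_of H ` mor H = perm_catenary_of T ` mor T"
  proof (intro equalityI subsetI)
    fix N assume "N \<in> perm_catenary_of H ` mor H"
    then obtain a where "a \<in> mor H" "N = perm_catenary_of H a" by auto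
    then show "N \<in> perm_catenary_of T ` mor T"
      using perm_catenary_of_hom[of a "\<phi> a"] by (simp add: T.assoc_mor_refl hom_mor)
  next
    fix N assume "N \<in> perm_catenary_of T ` mor T"
    then obtain b where b: "b \<in> mor T" "N = perm_catenary_of T b" by auto
    then obtain e a h where "e \<in> units T" "a \<in> mor H" "h \<in> units T" "tgt T e = src T (\<phi> a)"
      "tgt T (\<phi> a) = src T h" "b = e \<odot>\<^bsub>T\<^esub> \<phi> a \<odot>\<^bsub>T\<^esub> h"
      using weak_transfer unfolding weak_transfer_hom_def transfer_T1_def by blast
    then have "a \<in> mor H" "assoc_mor T (\<phi> a) b" by (simp_all add: T.assoc_morI hom_mor)
    then show "N \<in> perm_catenary_of H ` mor H"
      using perm_catenary_of_hom[of a b] b(2) image_eqI by metis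
  qed
  then show ?thesis by (simp add: perm_catenary_def)
qed

end

theorem proposition4p8:
  fixes H :: "'a small_cat" and T :: "'b small_cat" and \<phi> :: "'a \<Rightarrow> 'b"
  assumes "cancellative_category H" and "atomic H"
    and "cancellative_category T" and "atomic T"
    and "weak_transfer_hom H T \<phi>" and "isoatomic H T \<phi>"
  shows "(\<forall>a\<in>mor H. \<forall>z\<in>perm_facts_of H a. \<forall>z'\<in>perm_facts_of H a.
            perm_dist H z z' = perm_dist T (perm_extension T \<phi> z) (perm_extension T \<phi> z'))
         \<and> perm_catenary H = perm_catenary T"
proof -
  interpret isoatomic_weak_transfer H T \<phi>
    using assms by (simp add: isoatomic_weak_transfer_def isoatomic_weak_transfer_axioms_def)
  show ?thesis using perm_dist_hom perm_catenary_hom by blast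
qed

end
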